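(* Let $S$ be a left Ore set in a domain $R$, let $M$ be a left $R$-module, and let $\varepsilon := \varepsilon_{S,R,M} : M \to S^{-1}M$ be the localization map. (a) Let $Q$ be a left $S^{-1}R$-submodule of $S^{-1}M$. Then $Q = (Q^c)^e$ with respect to $\varepsilon$. In particular, any left $S^{-1}R$-submodule of $S^{-1}M$ is the extension of a left $R$-submodule of $M$ with respect to $\varepsilon$. (b) Let $P$ be a left $R$-submodule of $M$. Then $P^e = S^{-1}P$ and $(P^e)^c = P^S$ with respect to $\varepsilon$. In particular, $P^S$ is a left $R$-submodule of $M$.
   Context: Rings are associative, unital and non-trivial, not necessarily commutative. A subset $S$ of a domain $R$ is a left Ore set if $1 \in S$, $0 \notin S$, $S$ is closed under multiplication, and for all $s \in S$, $r \in R$ there exist $\tilde s \in S$, $\tilde r \in R$ with $\tilde s r = \tilde r s$. $S^{-1}R$ is the left Ore localization of $R$ at $S$, whose elements are (classes of) pairs $(s,r) \in S \times R$, representing $s^{-1}r$; $R$ embeds via $\rho_{S,R}: r \mapsto (1,r)$. The left Ore localization of $M$ at $S$ is the left $S^{-1}R$-module $S^{-1}M := S^{-1}R \otimes_R M$; every element of it has the form $(s,m) := (s,1) \otimes m$ with $s \in S$, $m \in M$. The localization map is $\varepsilon_{S,R,M} : M \to S^{-1}M$, $m \mapsto (1,1) \otimes m$, a homomorphism of left $R$-modules. For a submodule $P \subseteq M$, $S^{-1}P$ is regarded as a submodule of $S^{-1}M$ (the functor $S^{-1}R\otimes_R -$ is exact), namely $\{(s,p) \mid s \in S, p \in P\}$.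 With respect to $\varepsilon$: the extension of a left $R$-submodule $P$ of $M$ is $P^e := $ the left $S^{-1}R$-submodule of $S^{-1}M$ generated by $\varepsilon(P)$; the contraction of a left $S^{-1}R$-submodule $Q$ of $S^{-1}M$ is $Q^c := \varepsilon^{-1}(Q)$, a left $R$-submodule of $M$. The $S$-closure (local closure at $S$) of $P$ is $P^S := \{m \in M \mid \exists\, s \in S : sm \in P\}$. *)

theory Defs
  imports "HOL-Algebra.Module" "HOL-Algebra.Free_Abelian_Groups"
begin

section \<open>Non-commutative domains and left modules\<close>

text \<open>The locales \<open>domain\<close> and \<open>module\<close> of HOL-Algebra assume a commutative ring;
  the following are their analogues over a ring that need not be commutative.\<close>

locale nc_domain = ring R for R (structure) +
  assumes one_not_zero: "\<one> \<noteq> \<zero>"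
    and integral: "\<lbrakk>a \<otimes> b = \<zero>; a \<in> carrier R; b \<in> carrier R\<rbrakk> \<Longrightarrow> a = \<zero> \<or> b = \<zero>"

locale left_module = R?: ring R + M?: abelian_group M for R (structure) and M (structure) +
  assumes smult_closed:
      "\<lbrakk>a \<in> carrier R; x \<in> carrier M\<rbrakk> \<Longrightarrow> a \<odot>\<^bsub>M\<^esub> x \<in> carrier M"
    and smult_l_distr:
      "\<lbrakk>a \<in> carrier R; b \<in> carrier R; x \<in> carrier M\<rbrakk> \<Longrightarrow>
        (a \<oplus>\<^bsub>R\<^esub> b) \<odot>\<^bsub>M\<^esub> x = a \<odot>\<^bsub>M\<^esub> x \<oplus>\<^bsub>M\<^esub> b \<odot>\<^bsub>M\<^esub> x"
    and smult_r_distr: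
      "\<lbrakk>a \<in> carrier R; x \<in> carrier M; y \<in> carrier M\<rbrakk> \<Longrightarrow>
        a \<odot>\<^bsub>M\<^esub> (x \<oplus>\<^bsub>M\<^esub> y) = a \<odot>\<^bsub>M\<^esub> x \<oplus>\<^bsub>M\<^esub> a \<odot>\<^bsub>M\<^esub> y"
    and smult_assoc:
      "\<lbrakk>a \<in> carrier R; b \<in> carrier R; x \<in> carrier M\<rbrakk> \<Longrightarrow>
        (a \<otimes>\<^bsub>R\<^esub> b) \<odot>\<^bsub>M\<^esub> x = a \<odot>\<^bsub>M\<^esub> (b \<odot>\<^bsub>M\<^esub> x)"
    and smult_one:
      "x \<in> carrier M \<Longrightarrow> \<one>\<^bsub>R\<^esub> \<odot>\<^bsub>M\<^esub> x = x"

text \<open>The library predicate \<open>submodule N R M\<close> makes no commutativity assumption and is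
  used below for left submodules.\<close>

definition submodule_generated ::
  "('a, 'r) ring_scheme \<Rightarrow> ('a, 'b, 'm) module_scheme \<Rightarrow> 'b set \<Rightarrow> 'b set" where
  "submodule_generated R M X = \<Inter> {N. submodule N R M \<and> X \<subseteq> N}"

section \<open>Left Ore localization of a domain\<close>

definition left_ore_set :: "('a, 'r) ring_scheme \<Rightarrow> 'a set \<Rightarrow> bool" where
  "left_ore_set R S \<longleftrightarrow>
     S \<subseteq> carrier R \<and> \<one>\<^bsub>R\<^esub> \<in> S \<and> \<zero>\<^bsub>R\<^esub> \<notin> S \<and>
     (\<forall>s\<in>S. \<forall>t\<in>S. s \<otimes>\<^bsub>R\<^esub> t \<in> S) \<and>
     (\<forall>s\<in>S. \<forall>r\<in>carrier R. \<exists>s'\<in>S. \<exists>r'\<in>carrier R. s' \<otimes>\<^bsub>R\<^esub> r = r' \<otimes>\<^bsub>R\<^esub> s)"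

text \<open>The pair \<open>(s, r)\<close> stands for the left fraction \<open>s\<^sup>-\<^sup>1 r\<close>. Two pairs are
  identified if they can be expanded to the same pair by multiplication from the left; the
  relation is symmetric and transitive when \<open>S\<close> is a left Ore set in a domain.\<close>

definition ore_rel :: "('a, 'r) ring_scheme \<Rightarrow> 'a set \<Rightarrow> (('a \<times> 'a) \<times> ('a \<times> 'a)) set" where
  "ore_rel R S = {((s1, r1), (s2, r2)). s1 \<in> S \<and> r1 \<in> carrier R \<and> s2 \<in> S \<and> r2 \<in> carrier R \<and>
     (\<exists>s'\<in>S. \<exists>r'\<in>carrier R.
        s' \<otimes>\<^bsub>R\<^esub> s2 = r' \<otimes>\<^bsub>R\<^esub> s1 \<and> s' \<otimes>\<^bsub>R\<^esub> r2 = r' \<otimes>\<^bsub>R\<^esub> r1)}"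

definition ore_frac :: "('a, 'r) ring_scheme \<Rightarrow> 'a set \<Rightarrow> 'a \<Rightarrow> 'a \<Rightarrow> ('a \<times> 'a) set" where
  "ore_frac R S s r = ore_rel R S `` {(s, r)}"

text \<open>The operations on classes are
  \<open>s1\<^sup>-\<^sup>1 r1 + s2\<^sup>-\<^sup>1 r2 = (s' s1)\<^sup>-\<^sup>1 (s' r1 + r' r2)\<close> where \<open>s' s1 = r' s2\<close>, and
  \<open>s1\<^sup>-\<^sup>1 r1 \<cdot> s2\<^sup>-\<^sup>1 r2 = (s' s1)\<^sup>-\<^sup>1 (r' r2)\<close> where \<open>s' r1 = r' s2\<close>.
  They are written as the union over all choices of representatives and of \<open>s'\<close>, \<open>r'\<close>;
  as the resulting class does not depend on these choices, the union is that class.\<close>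

definition ore_add ::
  "('a, 'r) ring_scheme \<Rightarrow> 'a set \<Rightarrow> ('a \<times> 'a) set \<Rightarrow> ('a \<times> 'a) set \<Rightarrow> ('a \<times> 'a) set" where
  "ore_add R S A B =
     \<Union> {ore_frac R S (s' \<otimes>\<^bsub>R\<^esub> s1) (s' \<otimes>\<^bsub>R\<^esub> r1 \<oplus>\<^bsub>R\<^esub> r' \<otimes>\<^bsub>R\<^esub> r2) | s1 r1 s2 r2 s' r'.
         (s1, r1) \<in> A \<and> (s2, r2) \<in> B \<and> s' \<in> S \<and> r' \<in> carrier R \<and>
         s' \<otimes>\<^bsub>R\<^esub> s1 = r' \<otimes>\<^bsub>R\<^esub> s2}"

definition ore_mult ::
  "('a, 'r) ring_scheme \<Rightarrow> 'a set \<Rightarrow> ('a \<times> 'a) set \<Rightarrow> ('a \<times> 'a) set \<Rightarrow> ('a \<times> 'a) set" where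
  "ore_mult R S A B =
     \<Union> {ore_frac R S (s' \<otimes>\<^bsub>R\<^esub> s1) (r' \<otimes>\<^bsub>R\<^esub> r2) | s1 r1 s2 r2 s' r'.
         (s1, r1) \<in> A \<and> (s2, r2) \<in> B \<and> s' \<in> S \<and> r' \<in> carrier R \<and>
         s' \<otimes>\<^bsub>R\<^esub> r1 = r' \<otimes>\<^bsub>R\<^esub> s2}"

definition ore_loc :: "('a, 'r) ring_scheme \<Rightarrow> 'a set \<Rightarrow> ('a \<times> 'a) set ring" where
  "ore_loc R S =
     \<lparr>carrier = (S \<times> carrier R) // ore_rel R S,
      monoid.mult = ore_mult R S,
      monoid.one = ore_frac R S \<one>\<^bsub>R\<^esub> \<one>\<^bsub>R\<^esub>,
      ring.zero = ore_frac R S \<one>\<^bsub>R\<^esub> \<zero>\<^bsub>R\<^esub>,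
      ring.add = ore_add R S\<rparr>"

definition ore_emb :: "('a, 'r) ring_scheme \<Rightarrow> 'a set \<Rightarrow> 'a \<Rightarrow> ('a \<times> 'a) set" where
  "ore_emb R S r = ore_frac R S \<one>\<^bsub>R\<^esub> r"

section \<open>Extension of scalars along a ring homomorphism\<close>

text \<open>For a ring homomorphism \<open>\<phi>\<close> from \<open>R\<close> to \<open>T\<close> and a left \<open>R\<close>-module \<open>M\<close>, the tensor
  product \<open>T \<otimes>\<^sub>R M\<close>, where \<open>R\<close> acts on \<open>T\<close> from the right through \<open>\<phi>\<close>, is the quotient of
  the free abelian group on \<open>T \<times> M\<close> by the subgroup generated by the following elements.\<close>

definition tensor_relators ::
  "('a, 'r) ring_scheme \<Rightarrow> ('t, 's) ring_scheme \<Rightarrow> ('a \<Rightarrow> 't) \<Rightarrow> ('a, 'b, 'm) module_scheme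
    \<Rightarrow> ('t \<times> 'b \<Rightarrow>\<^sub>0 int) set" where
  "tensor_relators R T \<phi> M =
     {frag_of (t \<oplus>\<^bsub>T\<^esub> u, m) - frag_of (t, m) - frag_of (u, m) | t u m.
        t \<in> carrier T \<and> u \<in> carrier T \<and> m \<in> carrier M} \<union>
     {frag_of (t, m \<oplus>\<^bsub>M\<^esub> n) - frag_of (t, m) - frag_of (t, n) | t m n.
        t \<in> carrier T \<and> m \<in> carrier M \<and> n \<in> carrier M} \<union>
     {frag_of (t \<otimes>\<^bsub>T\<^esub> \<phi> r, m) - frag_of (t, r \<odot>\<^bsub>M\<^esub> m) | t r m.
        t \<in> carrier T \<and> r \<in> carrier R \<and> m \<in> carrier M}"

definition tensor_free ::
  "('t, 's) ring_scheme \<Rightarrow> ('a, 'b, 'm) module_scheme \<Rightarrow> ('t \<times> 'b \<Rightarrow>\<^sub>0 int) monoid" where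
  "tensor_free T M = free_Abelian_group (carrier T \<times> carrier M)"

definition tensor_kernel ::
  "('a, 'r) ring_scheme \<Rightarrow> ('t, 's) ring_scheme \<Rightarrow> ('a \<Rightarrow> 't) \<Rightarrow> ('a, 'b, 'm) module_scheme
    \<Rightarrow> ('t \<times> 'b \<Rightarrow>\<^sub>0 int) set" where
  "tensor_kernel R T \<phi> M = generate (tensor_free T M) (tensor_relators R T \<phi> M)"

definition simple_tensor ::
  "('a, 'r) ring_scheme \<Rightarrow> ('t, 's) ring_scheme \<Rightarrow> ('a \<Rightarrow> 't) \<Rightarrow> ('a, 'b, 'm) module_scheme
    \<Rightarrow> 't \<Rightarrow> 'b \<Rightarrow> ('t \<times> 'b \<Rightarrow>\<^sub>0 int) set" where
  "simple_tensor R T \<phi> M t m = tensor_kernel R T \<phi> M #>\<^bsub>tensor_free T M\<^esub> frag_of (t, m)"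

text \<open>The left action of \<open>T\<close> is induced by \<open>t \<cdot> (u \<otimes> m) = (t u) \<otimes> m\<close>, extended linearly;
  again the union over the representatives of a coset is a single coset. The fields
  \<open>mult\<close> and \<open>one\<close>, which the record type inherits from rings, carry no meaning for modules.\<close>

definition scalar_extension ::
  "('a, 'r) ring_scheme \<Rightarrow> ('t, 's) ring_scheme \<Rightarrow> ('a \<Rightarrow> 't) \<Rightarrow> ('a, 'b, 'm) module_scheme
    \<Rightarrow> ('t, ('t \<times> 'b \<Rightarrow>\<^sub>0 int) set) module" where
  "scalar_extension R T \<phi> M =
     (let F = tensor_free T M; K = tensor_kernel R T \<phi> M in
      \<lparr>carrier = carrier (F Mod K),
       monoid.mult = undefined,
       monoid.one = undefined,
       ring.zero = \<one>\<^bsub>F Mod K\<^esub>,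
       ring.add = monoid.mult (F Mod K),
       smult = (\<lambda>t X. \<Union>x\<in>X. K #>\<^bsub>F\<^esub> frag_extend (\<lambda>(u, m). frag_of (t \<otimes>\<^bsub>T\<^esub> u, m)) x)\<rparr>)"

section \<open>Left Ore localization of a module\<close>

definition ore_mod ::
  "('a, 'r) ring_scheme \<Rightarrow> 'a set \<Rightarrow> ('a, 'b, 'm) module_scheme
    \<Rightarrow> (('a \<times> 'a) set, (('a \<times> 'a) set \<times> 'b \<Rightarrow>\<^sub>0 int) set) module" where
  "ore_mod R S M = scalar_extension R (ore_loc R S) (ore_emb R S) M"

text \<open>The element \<open>(s, m) = (s, 1) \<otimes> m\<close> of the localized module.\<close>

definition mod_frac ::
  "('a, 'r) ring_scheme \<Rightarrow> 'a set \<Rightarrow> ('a, 'b, 'm) module_scheme \<Rightarrow> 'a \<Rightarrow> 'b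
    \<Rightarrow> (('a \<times> 'a) set \<times> 'b \<Rightarrow>\<^sub>0 int) set" where
  "mod_frac R S M s m =
     simple_tensor R (ore_loc R S) (ore_emb R S) M (ore_frac R S s \<one>\<^bsub>R\<^esub>) m"

definition loc_map ::
  "('a, 'r) ring_scheme \<Rightarrow> 'a set \<Rightarrow> ('a, 'b, 'm) module_scheme \<Rightarrow> 'b
    \<Rightarrow> (('a \<times> 'a) set \<times> 'b \<Rightarrow>\<^sub>0 int) set" where
  "loc_map R S M m = mod_frac R S M \<one>\<^bsub>R\<^esub> m"

text \<open>The localization of a submodule \<open>P\<close>, regarded as a subset of the localization of \<open>M\<close>.\<close>

definition loc_submodule ::
  "('a, 'r) ring_scheme \<Rightarrow> 'a set \<Rightarrow> ('a, 'b, 'm) module_scheme \<Rightarrow> 'b set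
    \<Rightarrow> (('a \<times> 'a) set \<times> 'b \<Rightarrow>\<^sub>0 int) set set" where
  "loc_submodule R S M P = {mod_frac R S M s p | s p. s \<in> S \<and> p \<in> P}"

definition extension ::
  "('a, 'r) ring_scheme \<Rightarrow> 'a set \<Rightarrow> ('a, 'b, 'm) module_scheme \<Rightarrow> 'b set
    \<Rightarrow> (('a \<times> 'a) set \<times> 'b \<Rightarrow>\<^sub>0 int) set set" where
  "extension R S M P = submodule_generated (ore_loc R S) (ore_mod R S M) (loc_map R S M ` P)"

definition contraction ::
  "('a, 'r) ring_scheme \<Rightarrow> 'a set \<Rightarrow> ('a, 'b, 'm) module_scheme
    \<Rightarrow> (('a \<times> 'a) set \<times> 'b \<Rightarrow>\<^sub>0 int) set set \<Rightarrow> 'b set" where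
  "contraction R S M Q = {m \<in> carrier M. loc_map R S M m \<in> Q}"

definition local_closure ::
  "'a set \<Rightarrow> ('a, 'b, 'm) module_scheme \<Rightarrow> 'b set \<Rightarrow> 'b set" where
  "local_closure S M P = {m \<in> carrier M. \<exists>s\<in>S. s \<odot>\<^bsub>M\<^esub> m \<in> P}"

end

theory Submission
  imports Defs
begin

text \<open>Every element of \<open>S\<^sup>-\<^sup>1M\<close> is a single fraction \<open>s\<^sup>-\<^sup>1m\<close>: fractions can be brought to a common
  denominator, so those with numerators in a submodule \<open>P\<close> form an \<open>S\<^sup>-\<^sup>1R\<close>-submodule, and simple
  tensors are fractions. Since \<open>s\<^sup>-\<^sup>1m\<close> and \<open>\<epsilon>(m)\<close> are multiples of each other by elements of
  \<open>S\<^sup>-\<^sup>1R\<close>, a submodule of \<open>S\<^sup>-\<^sup>1M\<close> contains both or neither. This gives \<open>P\<^sup>e = S\<^sup>-\<^sup>1P\<close>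
  (\<open>extension_eq_loc_submodule\<close>) and \<open>Q = S\<^sup>-\<^sup>1(Q\<^sup>c)\<close> (\<open>loc_submodule_contraction\<close>), hence
  \<open>Q = (Q\<^sup>c)\<^sup>e\<close>.

  For \<open>(P\<^sup>e)\<^sup>c = P\<^sup>S\<close> one inclusion is \<open>\<epsilon>(m) = s\<^sup>-\<^sup>1(s m)\<close>. The other needs that an equation
  \<open>s\<^sup>-\<^sup>1m = s'\<^sup>-\<^sup>1m'\<close> in the tensor product can be multiplied out to an equation in \<open>M\<close>
  (\<open>mod_frac_eqD\<close>). In a domain the numerator of a fraction \<open>t\<close> with respect to a given
  denominator \<open>d\<close> is unique, so there is a homomorphism \<open>h\<^sub>d\<close> from the free abelian group on
  \<open>S\<^sup>-\<^sup>1R \<times> M\<close> to \<open>M\<close> that sends \<open>(t, m)\<close> to \<open>(d t) m\<close> whenever \<open>d t\<close> lies in \<open>R\<close>. Each relator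
  of the tensor product is killed by \<open>h\<^sub>d\<close> once \<open>d\<close> is a denominator for the scalars that occur
  in it, and likewise for all left multiples of \<open>d\<close> in \<open>S\<close>; as two elements of \<open>S\<close> have a common
  left multiple in \<open>S\<close>, the same holds for each sum of relators (\<open>kernel_vanishes\<close>).

  The operations of \<open>S\<^sup>-\<^sup>1R\<close> are accessed only through \<open>d\<^sup>-\<^sup>1a + d\<^sup>-\<^sup>1b = d\<^sup>-\<^sup>1(a + b)\<close> and
  \<open>d\<^sup>-\<^sup>1(c s) \<cdot> s\<^sup>-\<^sup>1r = d\<^sup>-\<^sup>1(c r)\<close> (\<open>add_frac\<close> and \<open>mult_frac\<close>); besides closure, only
  distributivity from the left and associativity with a last factor from \<open>R\<close> are needed, to see
  that \<open>S\<^sup>-\<^sup>1R\<close> acts on the tensor product.\<close>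

section \<open>Left Ore fractions\<close>

text \<open>A left Ore set \<open>S\<close> in a domain \<open>R\<close>.\<close>

locale ore_domain = nc_domain R for R (structure) +
  fixes S :: "'a set"
  assumes left_ore: "left_ore_set R S"
begin

lemma S_closed: "s \<in> S \<Longrightarrow> s \<in> carrier R"
  and one_in_S: "\<one> \<in> S"
  and S_mult: "\<lbrakk>s \<in> S; t \<in> S\<rbrakk> \<Longrightarrow> s \<otimes> t \<in> S"
  and S_nonzero: "s \<in> S \<Longrightarrow> s \<noteq> \<zero>"
  using left_ore unfolding left_ore_set_def by auto

lemma ore_condition:
  assumes "s \<in> S" "r \<in> carrier R"
  obtains u v where "u \<in> S" "v \<in> carrier R" "u \<otimes> r = v \<otimes> s"
  using left_ore assms unfolding left_ore_set_def by blast

lemma cancel_left: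
  assumes eq: "a \<otimes> x = a \<otimes> y" and "a \<noteq> \<zero>" and [simp]: "a \<in> carrier R" "x \<in> carrier R" "y \<in> carrier R"
  shows "x = y"
proof -
  have "a \<otimes> (x \<ominus> y) = \<zero>"
    using eq by (simp add: a_minus_def r_distr r_minus r_neg)
  then show ?thesis
    using integral[of a "x \<ominus> y"] \<open>a \<noteq> \<zero>\<close> add.inv_equality[of x "\<ominus> y"] by (simp add: a_minus_def)
qed

lemma cancel_right:
  assumes eq: "x \<otimes> a = y \<otimes> a" and "a \<noteq> \<zero>" and [simp]: "a \<in> carrier R" "x \<in> carrier R" "y \<in> carrier R"
  shows "x = y"
proof -
  have "(x \<ominus> y) \<otimes> a = \<zero>"
    using eq by (simp add: a_minus_def l_distr l_minus r_neg)
  then show ?thesis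
    using integral[of "x \<ominus> y" a] \<open>a \<noteq> \<zero>\<close> add.inv_equality[of x "\<ominus> y"] by (simp add: a_minus_def)
qed

lemma ore_relD:
  assumes "((s1, r1), (s2, r2)) \<in> ore_rel R S"
  obtains u v where "u \<in> S" "v \<in> carrier R" "u \<otimes> s2 = v \<otimes> s1" "u \<otimes> r2 = v \<otimes> r1"
    "s1 \<in> S" "r1 \<in> carrier R" "s2 \<in> S" "r2 \<in> carrier R"
  using assms unfolding ore_rel_def by blast

lemma ore_relI:
  assumes "u \<in> S" "v \<in> carrier R" "u \<otimes> s2 = v \<otimes> s1" "u \<otimes> r2 = v \<otimes> r1"
    "s1 \<in> S" "r1 \<in> carrier R" "s2 \<in> S" "r2 \<in> carrier R"
  shows "((s1, r1), (s2, r2)) \<in> ore_rel R S"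
  using assms unfolding ore_rel_def by blast

lemma ore_rel_sym:
  assumes "((s1, r1), (s2, r2)) \<in> ore_rel R S"
  shows "((s2, r2), (s1, r1)) \<in> ore_rel R S"
proof -
  obtain u v where uv: "u \<in> S" "v \<in> carrier R" "u \<otimes> s2 = v \<otimes> s1" "u \<otimes> r2 = v \<otimes> r1"
    and S: "s1 \<in> S" "r1 \<in> carrier R" "s2 \<in> S" "r2 \<in> carrier R"
    using assms by (rule ore_relD)
  note [simp] = uv(2) S(2,4) S_closed[OF uv(1)] S_closed[OF S(1)] S_closed[OF S(3)]
  obtain p q where pq: "p \<in> S" "q \<in> carrier R" "p \<otimes> s1 = q \<otimes> (u \<otimes> s2)"
    using ore_condition[OF S_mult[OF uv(1) S(3)], of s1] by auto
  note [simp] = pq(2) S_closed[OF pq(1)]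
  have "p \<otimes> s1 = (q \<otimes> v) \<otimes> s1"
    using pq(3) uv(3) by (simp add: m_assoc)
  then have p: "p = q \<otimes> v"
    by (rule cancel_right) (use S_nonzero[OF S(1)] in simp_all)
  show ?thesis
  proof (rule ore_relI)
    show "p \<otimes> s1 = (q \<otimes> u) \<otimes> s2" using pq(3) by (simp add: m_assoc)
    show "p \<otimes> r1 = (q \<otimes> u) \<otimes> r2" using uv(4) by (simp add: m_assoc p)
  qed (use pq S in simp_all)
qed

lemma ore_rel_trans:
  assumes "((s1, r1), (s2, r2)) \<in> ore_rel R S" "((s2, r2), (s3, r3)) \<in> ore_rel R S"
  shows "((s1, r1), (s3, r3)) \<in> ore_rel R S"
proof -
  obtain u v where uv: "u \<in> S" "v \<in> carrier R" "u \<otimes> s2 = v \<otimes> s1" "u \<otimes> r2 = v \<otimes> r1"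
    and S: "s1 \<in> S" "r1 \<in> carrier R" "s2 \<in> S" "r2 \<in> carrier R"
    using assms(1) by (rule ore_relD)
  obtain u' v' where uv': "u' \<in> S" "v' \<in> carrier R" "u' \<otimes> s3 = v' \<otimes> s2" "u' \<otimes> r3 = v' \<otimes> r2"
    and S': "s3 \<in> S" "r3 \<in> carrier R"
    using assms(2) by (rule ore_relD)
  obtain p q where pq: "p \<in> S" "q \<in> carrier R" "p \<otimes> v' = q \<otimes> u"
    using ore_condition[OF uv(1) uv'(2)] .
  note [simp] = uv(2) uv'(2) pq(2) S(2,4) S'(2) S_closed[OF uv(1)] S_closed[OF uv'(1)]
    S_closed[OF pq(1)] S_closed[OF S(1)] S_closed[OF S(3)] S_closed[OF S'(1)]
  have "(p \<otimes> u') \<otimes> z3 = (q \<otimes> v) \<otimes> z1"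
    if "u' \<otimes> z3 = v' \<otimes> z2" "u \<otimes> z2 = v \<otimes> z1" "z1 \<in> carrier R" "z2 \<in> carrier R" "z3 \<in> carrier R"
    for z1 z2 z3
  proof -
    have "(p \<otimes> u') \<otimes> z3 = (p \<otimes> v') \<otimes> z2" using that by (simp add: m_assoc)
    also have "\<dots> = (q \<otimes> v) \<otimes> z1" using that by (simp add: pq(3) m_assoc)
    finally show ?thesis .
  qed
  then show ?thesis
    using S S' uv uv' pq by (intro ore_relI[of "p \<otimes> u'" "q \<otimes> v"]) (auto intro: S_mult)
qed

lemma equiv_ore_rel: "equiv (S \<times> carrier R) (ore_rel R S)"
proof (rule equivI)
  show "ore_rel R S \<subseteq> (S \<times> carrier R) \<times> (S \<times> carrier R)"
    by (auto simp: ore_rel_def)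
  show "refl_on (S \<times> carrier R) (ore_rel R S)"
    by (auto intro!: refl_onI ore_relI[of \<one> \<one>] simp: one_in_S)
  show "sym (ore_rel R S)"
    by (auto intro!: symI ore_rel_sym)
  show "trans (ore_rel R S)"
    by (auto intro!: transI intro: ore_rel_trans)
qed

abbreviation frac :: "'a \<Rightarrow> 'a \<Rightarrow> ('a \<times> 'a) set" where
  "frac \<equiv> ore_frac R S"

abbreviation T :: "('a \<times> 'a) set ring" where
  "T \<equiv> ore_loc R S"

lemma frac_in_carrier: "\<lbrakk>s \<in> S; r \<in> carrier R\<rbrakk> \<Longrightarrow> frac s r \<in> carrier T"
  by (simp add: ore_loc_def ore_frac_def quotientI)

lemma carrier_cases:
  assumes "t \<in> carrier T"
  obtains s r where "s \<in> S" "r \<in> carrier R" "t = frac s r"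
  using assms by (auto simp: ore_loc_def ore_frac_def elim!: quotientE)

lemma mem_frac_iff:
  assumes "s \<in> S" "r \<in> carrier R"
  shows "(s', r') \<in> frac s r \<longleftrightarrow> s' \<in> S \<and> r' \<in> carrier R \<and> frac s' r' = frac s r"
  using equiv_class_eq_iff[OF equiv_ore_rel, of "(s, r)" "(s', r')"] assms
  by (auto simp: ore_frac_def)

lemma frac_expand:
  assumes "s \<in> S" "r \<in> carrier R" "a \<in> carrier R" "a \<otimes> s \<in> S"
  shows "frac (a \<otimes> s) (a \<otimes> r) = frac s r"
proof -
  have "((s, r), (a \<otimes> s, a \<otimes> r)) \<in> ore_rel R S"
    by (rule ore_relI[of \<one> a]) (use assms one_in_S in \<open>auto simp: S_closed\<close>)
  then show ?thesis
    unfolding ore_frac_def using equiv_class_eq[OF equiv_ore_rel] by blast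
qed

text \<open>The product \<open>(c s)(s\<^sup>-\<^sup>1r) = c r\<close> depends only on the element \<open>c s\<close> and on the fraction. The
  comparison takes place in \<open>R\<close> itself because elements of \<open>S\<close> can be cancelled in a domain. The
  well-definedness of the operations on fractions and the uniqueness of numerators follow from
  this.\<close>

lemma frac_eqD:
  assumes eq: "frac s r = frac t q"
    and S: "s \<in> S" "r \<in> carrier R" "t \<in> S" "q \<in> carrier R"
    and c: "c \<in> carrier R" "c' \<in> carrier R" "c \<otimes> s = c' \<otimes> t"
  shows "c \<otimes> r = c' \<otimes> q"
proof -
  have "((s, r), (t, q)) \<in> ore_rel R S"
    using eq_equiv_class[OF _ equiv_ore_rel] eq S by (simp add: ore_frac_def)
  then obtain u v where uv: "u \<in> S" "v \<in> carrier R" "u \<otimes> t = v \<otimes> s" "u \<otimes> q = v \<otimes> r"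
    by (rule ore_relD)
  obtain x y where xy: "x \<in> S" "y \<in> carrier R" "x \<otimes> c' = y \<otimes> u"
    using ore_condition[OF uv(1) c(2)] .
  note [simp] = S(2,4) c(1,2) uv(2) xy(2) S_closed[OF S(1)] S_closed[OF S(3)]
    S_closed[OF uv(1)] S_closed[OF xy(1)]
  have "(x \<otimes> c) \<otimes> s = (x \<otimes> c') \<otimes> t" using c(3) by (simp add: m_assoc)
  also have "\<dots> = (y \<otimes> v) \<otimes> s" using uv(3) by (simp add: xy(3) m_assoc)
  finally have "x \<otimes> c = y \<otimes> v"
    by (rule cancel_right) (use S_nonzero[OF S(1)] in simp_all)
  then have "x \<otimes> (c \<otimes> r) = y \<otimes> (v \<otimes> r)" by (simp flip: m_assoc)
  also have "\<dots> = (y \<otimes> u) \<otimes> q" using uv(4) by (simp add: m_assoc)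
  also have "\<dots> = x \<otimes> (c' \<otimes> q)" by (simp flip: xy(3) add: m_assoc)
  finally show ?thesis
    by (rule cancel_left) (use S_nonzero[OF xy(1)] in simp_all)
qed

lemma frac_inject:
  assumes "frac d a = frac d b" "d \<in> S" "a \<in> carrier R" "b \<in> carrier R"
  shows "a = b"
  using frac_eqD[OF assms(1), of \<one> \<one>] assms(2-) by (simp add: S_closed)

lemma common_multiple:
  assumes "d \<in> S" "e \<in> S"
  obtains x y where "x \<in> S" "y \<in> carrier R" "x \<otimes> d = y \<otimes> e" "x \<otimes> d \<in> S"
  using ore_condition[OF assms(2) S_closed[OF assms(1)]] S_mult[OF _ assms(1)] by metis

lemma common_denominator:
  assumes "t \<in> carrier T" "u \<in> carrier T"
  obtains d a b where "d \<in> S" "a \<in> carrier R" "b \<in> carrier R" "t = frac d a" "u = frac d b"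
proof -
  obtain s r where t: "s \<in> S" "r \<in> carrier R" "t = frac s r"
    using assms(1) by (rule carrier_cases)
  obtain s' r' where u: "s' \<in> S" "r' \<in> carrier R" "u = frac s' r'"
    using assms(2) by (rule carrier_cases)
  obtain x y where xy: "x \<in> S" "y \<in> carrier R" "x \<otimes> s = y \<otimes> s'" "x \<otimes> s \<in> S"
    using common_multiple[OF t(1) u(1)] .
  show thesis
  proof
    show "t = frac (x \<otimes> s) (x \<otimes> r)"
      using frac_expand[OF t(1,2) S_closed[OF xy(1)] xy(4)] t(3) by simp
    show "u = frac (x \<otimes> s) (y \<otimes> r')"
      using frac_expand[OF u(1,2) xy(2)] u(3) xy(3,4) by simp
  qed (use t u xy in \<open>auto simp: S_closed\<close>)
qed

text \<open>A fraction with denominator \<open>s\<close> can be multiplied on the left by any \<open>d\<^sup>-\<^sup>1 c s\<close>, and every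
  element can be brought to this form.\<close>

lemma compatible_denominator:
  assumes "t \<in> carrier T" "s \<in> S"
  obtains d c where "d \<in> S" "c \<in> carrier R" "t = frac d (c \<otimes> s)"
proof -
  obtain s' r where t: "s' \<in> S" "r \<in> carrier R" "t = frac s' r"
    using assms(1) by (rule carrier_cases)
  obtain u v where uv: "u \<in> S" "v \<in> carrier R" "u \<otimes> r = v \<otimes> s"
    using ore_condition[OF assms(2) t(2)] .
  show thesis
  proof
    show "t = frac (u \<otimes> s') (v \<otimes> s)"
      using frac_expand[OF t(1,2) S_closed[OF uv(1)] S_mult[OF uv(1) t(1)]] t(3) uv(3) by simp
  qed (use t uv S_mult in auto)
qed

text \<open>The sum and the product are unions over all choices of representatives and multipliers;
  in the next two proofs all members of the union are shown to be the same class.\<close>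

lemma add_frac:
  assumes d: "d \<in> S" "a \<in> carrier R" "b \<in> carrier R"
  shows "frac d a \<oplus>\<^bsub>T\<^esub> frac d b = frac d (a \<oplus> b)"
proof -
  have "frac (s' \<otimes> s1) (s' \<otimes> r1 \<oplus> r' \<otimes> r2) = frac d (a \<oplus> b)"
    if 1: "s1 \<in> S" "r1 \<in> carrier R" "frac s1 r1 = frac d a"
      and 2: "s2 \<in> S" "r2 \<in> carrier R" "frac s2 r2 = frac d b"
      and s': "s' \<in> S" "r' \<in> carrier R" "s' \<otimes> s1 = r' \<otimes> s2"
    for s1 r1 s2 r2 s' r'
  proof -
    have e: "s' \<otimes> s1 \<in> S" using s'(1) 1(1) by (rule S_mult)
    obtain x y where xy: "x \<in> S" "y \<in> carrier R" "x \<otimes> d = y \<otimes> (s' \<otimes> s1)" "x \<otimes> d \<in> S"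
      using common_multiple[OF d(1) e] .
    note [simp] = S_closed[OF xy(1)] xy(2) d(2,3) S_closed[OF d(1)] S_closed[OF s'(1)] s'(2)
       1(2) 2(2) S_closed[OF 1(1)] S_closed[OF 2(1)]
    have "x \<otimes> a = (y \<otimes> s') \<otimes> r1"
      by (rule frac_eqD[OF 1(3)[symmetric]]) (use d 1 xy in \<open>simp_all add: m_assoc\<close>)
    moreover have "x \<otimes> b = (y \<otimes> r') \<otimes> r2"
      by (rule frac_eqD[OF 2(3)[symmetric]]) (use d 2 xy s'(3) in \<open>simp_all add: m_assoc\<close>)
    ultimately have "x \<otimes> (a \<oplus> b) = y \<otimes> (s' \<otimes> r1 \<oplus> r' \<otimes> r2)"
      by (simp add: r_distr m_assoc)
    then show ?thesis
      using frac_expand[of d "a \<oplus> b" x] frac_expand[of "s' \<otimes> s1" "s' \<otimes> r1 \<oplus> r' \<otimes> r2" y] xy e d(1)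
      by simp
  qed
  note key = this
  let ?X = "{frac (s' \<otimes> s1) (s' \<otimes> r1 \<oplus> r' \<otimes> r2) | s1 r1 s2 r2 s' r'.
      (s1, r1) \<in> frac d a \<and> (s2, r2) \<in> frac d b \<and> s' \<in> S \<and> r' \<in> carrier R \<and>
      s' \<otimes> s1 = r' \<otimes> s2}"
  have "Z = frac d (a \<oplus> b)" if "Z \<in> ?X" for Z
    using that key d by (clarsimp simp: mem_frac_iff)
  moreover have "frac d (a \<oplus> b) \<in> ?X"
    unfolding mem_Collect_eq
    by (rule exI[of _ d], rule exI[of _ a], rule exI[of _ d], rule exI[of _ b],
        rule exI[of _ \<one>], rule exI[of _ \<one>])
      (use d in \<open>simp add: mem_frac_iff one_in_S S_closed\<close>)
  ultimately have "?X = {frac d (a \<oplus> b)}" by blast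
  then show ?thesis by (simp add: ore_loc_def ore_add_def)
qed

lemma mult_frac:
  assumes d: "d \<in> S" "c \<in> carrier R" "s \<in> S" "r \<in> carrier R"
  shows "frac d (c \<otimes> s) \<otimes>\<^bsub>T\<^esub> frac s r = frac d (c \<otimes> r)"
proof -
  note [simp] = d(2,4) S_closed[OF d(1)] S_closed[OF d(3)]
  have "frac (s' \<otimes> s1) (r' \<otimes> r2) = frac d (c \<otimes> r)"
    if 1: "s1 \<in> S" "r1 \<in> carrier R" "frac s1 r1 = frac d (c \<otimes> s)"
      and 2: "s2 \<in> S" "r2 \<in> carrier R" "frac s2 r2 = frac s r"
      and s': "s' \<in> S" "r' \<in> carrier R" "s' \<otimes> r1 = r' \<otimes> s2"
    for s1 r1 s2 r2 s' r'
  proof -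
    have e: "s' \<otimes> s1 \<in> S" using s'(1) 1(1) by (rule S_mult)
    obtain x y where xy: "x \<in> S" "y \<in> carrier R" "x \<otimes> d = y \<otimes> (s' \<otimes> s1)" "x \<otimes> d \<in> S"
      using common_multiple[OF d(1) e] .
    note [simp] = S_closed[OF xy(1)] xy(2) S_closed[OF s'(1)] s'(2)
       1(2) 2(2) S_closed[OF 1(1)] S_closed[OF 2(1)]
    have "x \<otimes> (c \<otimes> s) = (y \<otimes> s') \<otimes> r1"
      by (rule frac_eqD[OF 1(3)[symmetric]]) (use d 1 xy in \<open>simp_all add: m_assoc\<close>)
    then have "(x \<otimes> c) \<otimes> s = (y \<otimes> r') \<otimes> s2"
      using s'(3) by (simp add: m_assoc)
    then have "(x \<otimes> c) \<otimes> r = (y \<otimes> r') \<otimes> r2"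
      by (rule frac_eqD[OF 2(3)[symmetric] d(3,4) 2(1,2), rotated -1]) simp_all
    then show ?thesis
      using frac_expand[of d "c \<otimes> r" x] frac_expand[of "s' \<otimes> s1" "r' \<otimes> r2" y] xy e d(1)
      by (simp add: m_assoc)
  qed
  note key = this
  let ?X = "{frac (s' \<otimes> s1) (r' \<otimes> r2) | s1 r1 s2 r2 s' r'.
      (s1, r1) \<in> frac d (c \<otimes> s) \<and> (s2, r2) \<in> frac s r \<and> s' \<in> S \<and> r' \<in> carrier R \<and>
      s' \<otimes> r1 = r' \<otimes> s2}"
  have "Z = frac d (c \<otimes> r)" if "Z \<in> ?X" for Z
    using that key d by (clarsimp simp: mem_frac_iff)
  moreover have "frac d (c \<otimes> r) \<in> ?X"
    unfolding mem_Collect_eq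
    by (rule exI[of _ d], rule exI[of _ "c \<otimes> s"], rule exI[of _ s], rule exI[of _ r],
        rule exI[of _ \<one>], rule exI[of _ c])
      (use d in \<open>simp add: mem_frac_iff one_in_S S_closed\<close>)
  ultimately have "?X = {frac d (c \<otimes> r)}" by blast
  then show ?thesis by (simp add: ore_loc_def ore_mult_def)
qed

lemma T_add_closed:
  assumes "t \<in> carrier T" "u \<in> carrier T"
  shows "t \<oplus>\<^bsub>T\<^esub> u \<in> carrier T"
  by (rule common_denominator[OF assms]) (simp add: add_frac frac_in_carrier)

lemma T_mult_closed:
  assumes "t \<in> carrier T" "u \<in> carrier T"
  shows "t \<otimes>\<^bsub>T\<^esub> u \<in> carrier T"
proof -
  obtain s r where u: "s \<in> S" "r \<in> carrier R" "u = frac s r"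
    using assms(2) by (rule carrier_cases)
  obtain d c where t: "d \<in> S" "c \<in> carrier R" "t = frac d (c \<otimes> s)"
    using compatible_denominator[OF assms(1) u(1)] .
  show ?thesis using t u by (simp add: mult_frac frac_in_carrier)
qed

lemma T_left_distrib:
  assumes "t \<in> carrier T" "u \<in> carrier T" "v \<in> carrier T"
  shows "t \<otimes>\<^bsub>T\<^esub> (u \<oplus>\<^bsub>T\<^esub> v) = t \<otimes>\<^bsub>T\<^esub> u \<oplus>\<^bsub>T\<^esub> t \<otimes>\<^bsub>T\<^esub> v"
proof -
  obtain s a b where uv: "s \<in> S" "a \<in> carrier R" "b \<in> carrier R" "u = frac s a" "v = frac s b"
    using common_denominator[OF assms(2,3)] .
  obtain d c where t: "d \<in> S" "c \<in> carrier R" "t = frac d (c \<otimes> s)"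
    using compatible_denominator[OF assms(1) uv(1)] .
  show ?thesis using t uv by (simp add: mult_frac add_frac r_distr)
qed

lemma emb_in_carrier: "r \<in> carrier R \<Longrightarrow> ore_emb R S r \<in> carrier T"
  by (simp add: ore_emb_def frac_in_carrier one_in_S)

lemma frac_mult_emb:
  assumes "s \<in> S" "a \<in> carrier R" "r \<in> carrier R"
  shows "frac s a \<otimes>\<^bsub>T\<^esub> ore_emb R S r = frac s (a \<otimes> r)"
  using mult_frac[of s a \<one> r] assms by (simp add: ore_emb_def one_in_S)

text \<open>Associativity is shown for a last factor from \<open>R\<close> only, as it occurs in the relators of the
  tensor product.\<close>

lemma T_assoc_emb:
  assumes "t \<in> carrier T" "u \<in> carrier T" "r \<in> carrier R"
  shows "t \<otimes>\<^bsub>T\<^esub> (u \<otimes>\<^bsub>T\<^esub> ore_emb R S r) = (t \<otimes>\<^bsub>T\<^esub> u) \<otimes>\<^bsub>T\<^esub> ore_emb R S r"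
proof -
  obtain s a where u: "s \<in> S" "a \<in> carrier R" "u = frac s a"
    using assms(2) by (rule carrier_cases)
  obtain d c where t: "d \<in> S" "c \<in> carrier R" "t = frac d (c \<otimes> s)"
    using compatible_denominator[OF assms(1) u(1)] .
  show ?thesis using t u assms(3) by (simp add: mult_frac frac_mult_emb m_assoc)
qed

text \<open>\<open>numerator d t\<close> is the element \<open>d t\<close> of \<open>R\<close>, for those \<open>t\<close> that admit the denominator
  \<open>d\<close>, and \<open>0\<close> for all others.\<close>

definition numerator :: "'a \<Rightarrow> ('a \<times> 'a) set \<Rightarrow> 'a" where
  "numerator d t =
     (if \<exists>a\<in>carrier R. t = frac d a then SOME a. a \<in> carrier R \<and> t = frac d a else \<zero>)"

lemma numerator_closed: "numerator d t \<in> carrier R"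
  unfolding numerator_def by (auto intro: someI2)

lemma numerator_frac:
  assumes "d \<in> S" "a \<in> carrier R"
  shows "numerator d (frac d a) = a"
proof -
  have "(SOME b. b \<in> carrier R \<and> frac d a = frac d b) = a"
    by (rule some_equality) (use assms in \<open>auto dest: frac_inject\<close>)
  then show ?thesis using assms(2) by (auto simp: numerator_def)
qed

lemma numerator_frac_expand:
  assumes "d \<in> S" "a \<in> carrier R" "r \<in> carrier R" "r \<otimes> d \<in> S"
  shows "numerator (r \<otimes> d) (frac d a) = r \<otimes> a"
  using numerator_frac[of "r \<otimes> d" "r \<otimes> a"] frac_expand[of d a r] assms by simp

end

section \<open>The localized module\<close>

text \<open>In addition, a left \<open>R\<close>-module \<open>M\<close>. Its localization \<open>L\<close> is the quotient of the free abelian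
  group \<open>F\<close> on \<open>T \<times> M\<close> by the subgroup \<open>K\<close> generated by the relators, and \<open>cls x\<close> is the coset of
  \<open>x\<close>.\<close>

locale ore_module = ore_domain R S + left_module R M
  for R (structure) and S and M (structure)
begin

abbreviation F :: "(('a \<times> 'a) set \<times> 'c \<Rightarrow>\<^sub>0 int) monoid" where
  "F \<equiv> tensor_free T M"

abbreviation K :: "(('a \<times> 'a) set \<times> 'c \<Rightarrow>\<^sub>0 int) set" where
  "K \<equiv> tensor_kernel R T (ore_emb R S) M"

abbreviation cls :: "(('a \<times> 'a) set \<times> 'c \<Rightarrow>\<^sub>0 int) \<Rightarrow> (('a \<times> 'a) set \<times> 'c \<Rightarrow>\<^sub>0 int) set" where
  "cls x \<equiv> K #>\<^bsub>F\<^esub> x"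

abbreviation L :: "(('a \<times> 'a) set, (('a \<times> 'a) set \<times> 'c \<Rightarrow>\<^sub>0 int) set) module" where
  "L \<equiv> ore_mod R S M"

abbreviation tens :: "('a \<times> 'a) set \<Rightarrow> 'c \<Rightarrow> (('a \<times> 'a) set \<times> 'c \<Rightarrow>\<^sub>0 int) set" where
  "tens \<equiv> simple_tensor R T (ore_emb R S) M"

lemma group_F: "group F"
  by (simp add: tensor_free_def)

lemma F_ops [simp]: "x \<otimes>\<^bsub>F\<^esub> y = x + y" "\<one>\<^bsub>F\<^esub> = 0"
  by (simp_all add: tensor_free_def)

lemma F_inv: "x \<in> carrier F \<Longrightarrow> inv\<^bsub>F\<^esub> x = - x"
  by (simp add: tensor_free_def)

lemma F_closed: "0 \<in> carrier F" "\<lbrakk>x \<in> carrier F; y \<in> carrier F\<rbrakk> \<Longrightarrow> x + y \<in> carrier F"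
    "x \<in> carrier F \<Longrightarrow> - x \<in> carrier F" "\<lbrakk>x \<in> carrier F; y \<in> carrier F\<rbrakk> \<Longrightarrow> x - y \<in> carrier F"
    "\<lbrakk>t \<in> carrier T; m \<in> carrier M\<rbrakk> \<Longrightarrow> frag_of (t, m) \<in> carrier F"
  unfolding tensor_free_def carrier_free_Abelian_group_iff
  using keys_add[of x y] keys_diff[of x y] by auto

lemma relators_in_F: "tensor_relators R T (ore_emb R S) M \<subseteq> carrier F"
  unfolding tensor_relators_def
  by (auto intro!: F_closed T_add_closed T_mult_closed emb_in_carrier smult_closed)

lemma subgroup_K: "subgroup K F"
  unfolding tensor_kernel_def by (rule group.generate_is_subgroup[OF group_F relators_in_F])

lemma K_closed: "x \<in> K \<Longrightarrow> x \<in> carrier F" "0 \<in> K" "\<lbrakk>x \<in> K; y \<in> K\<rbrakk> \<Longrightarrow> x + y \<in> K" "x \<in> K \<Longrightarrow> - x \<in> K"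
  using subgroup.mem_carrier[OF subgroup_K, of x] subgroup.one_closed[OF subgroup_K]
    subgroup.m_closed[OF subgroup_K, of x y] subgroup.m_inv_closed[OF subgroup_K, of x] F_inv[of x]
  by auto

lemma relator_in_K: "x \<in> tensor_relators R T (ore_emb R S) M \<Longrightarrow> x \<in> K"
  unfolding tensor_kernel_def by (rule generate.incl)

lemma K_induct [consumes 1, case_names zero relator minus add]:
  assumes "x \<in> K" "P 0" "\<And>x. x \<in> tensor_relators R T (ore_emb R S) M \<Longrightarrow> P x"
    "\<And>x. x \<in> K \<Longrightarrow> P x \<Longrightarrow> P (- x)" "\<And>x y. x \<in> K \<Longrightarrow> y \<in> K \<Longrightarrow> P x \<Longrightarrow> P y \<Longrightarrow> P (x + y)"
  shows "P x"
  using assms(1) unfolding tensor_kernel_def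
proof (induction rule: generate.induct)
  case (inv h)
  then have "inv\<^bsub>F\<^esub> h = - h" using relators_in_F by (intro F_inv) auto
  then show ?case using inv assms(3,4) relator_in_K by simp
qed (use assms(2,3,5) in \<open>simp_all add: tensor_kernel_def\<close>)

lemma cls_conv: "cls x = (\<lambda>k. k + x) ` K"
  by (auto simp: r_coset_def)

lemma cls_eq_iff: "cls x = cls y \<longleftrightarrow> x - y \<in> K"
proof
  assume "cls x = cls y"
  then have "0 + x \<in> cls y" using K_closed(2) by (auto simp: cls_conv)
  then show "x - y \<in> K" by (auto simp: cls_conv)
next
  assume xy: "x - y \<in> K"
  have sub: "cls v \<subseteq> cls w" if "v - w \<in> K" for v w
  proof
    fix z assume "z \<in> cls v"
    then obtain k where "k \<in> K" "z = k + v" by (auto simp: cls_conv)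
    then have "z = (k + (v - w)) + w" "k + (v - w) \<in> K"
      using that by (simp_all add: K_closed)
    then show "z \<in> cls w" unfolding cls_conv by blast
  qed
  show "cls x = cls y"
    using sub[OF xy] sub[of y x] K_closed(4)[OF xy] by auto
qed

lemma carrier_L: "carrier L = cls ` carrier F"
  by (auto simp: ore_mod_def scalar_extension_def Let_def FactGroup_def RCOSETS_def)

lemma zero_L: "\<zero>\<^bsub>L\<^esub> = cls 0"
  by (simp add: ore_mod_def scalar_extension_def Let_def cls_conv)

lemma add_L: "cls x \<oplus>\<^bsub>L\<^esub> cls y = cls (x + y)"
proof -
  have "cls x <#>\<^bsub>F\<^esub> cls y = cls (x + y)"
  proof
    show "cls x <#>\<^bsub>F\<^esub> cls y \<subseteq> cls (x + y)"
      unfolding set_mult_def cls_conv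
      by (auto intro!: image_eqI[OF _ K_closed(3)] simp: algebra_simps)
    show "cls (x + y) \<subseteq> cls x <#>\<^bsub>F\<^esub> cls y"
      unfolding set_mult_def cls_conv using K_closed(2) by (force simp: algebra_simps)
  qed
  then show ?thesis
    by (simp add: ore_mod_def scalar_extension_def Let_def)
qed

text \<open>The union defining the scalar multiplication is a single coset because the homomorphism
  \<open>(u, m) \<mapsto> (t u, m)\<close> maps relators to relators.\<close>

lemma smult_L:
  assumes t: "t \<in> carrier T"
  shows "t \<odot>\<^bsub>L\<^esub> cls x = cls (frag_extend (\<lambda>(u, m). frag_of (t \<otimes>\<^bsub>T\<^esub> u, m)) x)"
proof -
  let ?E = "frag_extend (\<lambda>(u, m). frag_of (t \<otimes>\<^bsub>T\<^esub> u, m))"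
  have E_K: "?E k \<in> K" if "k \<in> K" for k
    using that
  proof (induction rule: K_induct)
    case (relator x)
    then have "?E x \<in> tensor_relators R T (ore_emb R S) M"
      unfolding tensor_relators_def
      by (auto simp: frag_extend_diff T_left_distrib[OF t] T_assoc_emb[OF t])
        (use T_mult_closed[OF t] in blast)+
    then show ?case by (rule relator_in_K)
  qed (simp_all add: K_closed frag_extend_minus frag_extend_add)
  have "cls (?E y) = cls (?E x)" if y: "y \<in> cls x" for y
  proof -
    obtain k where "k \<in> K" "y = k + x" using y by (auto simp: cls_conv)
    then show ?thesis using E_K by (simp add: cls_eq_iff frag_extend_add)
  qed
  moreover have "x \<in> cls x"
    using K_closed(2) by (force simp: cls_conv)
  ultimately have "(\<Union>y\<in>cls x. cls (?E y)) = cls (?E x)" by blast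
  then show ?thesis
    by (simp add: ore_mod_def scalar_extension_def Let_def)
qed

lemma comm_group_L: "comm_group (add_monoid L)"
proof (rule comm_groupI)
  fix X Y Z assume "X \<in> carrier (add_monoid L)" "Y \<in> carrier (add_monoid L)" "Z \<in> carrier (add_monoid L)"
  then obtain x y z where xyz: "x \<in> carrier F" "y \<in> carrier F" "z \<in> carrier F"
    and [simp]: "X = cls x" "Y = cls y" "Z = cls z"
    by (auto simp: carrier_L)
  show "X \<otimes>\<^bsub>add_monoid L\<^esub> Y \<in> carrier (add_monoid L)"
    using xyz by (simp add: add_L carrier_L F_closed)
  show "X \<otimes>\<^bsub>add_monoid L\<^esub> Y \<otimes>\<^bsub>add_monoid L\<^esub> Z = X \<otimes>\<^bsub>add_monoid L\<^esub> (Y \<otimes>\<^bsub>add_monoid L\<^esub> Z)"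
    "X \<otimes>\<^bsub>add_monoid L\<^esub> Y = Y \<otimes>\<^bsub>add_monoid L\<^esub> X"
    by (simp_all add: add_L add_ac)
  show "\<one>\<^bsub>add_monoid L\<^esub> \<otimes>\<^bsub>add_monoid L\<^esub> X = X"
    by (simp add: add_L zero_L)
  show "\<exists>Y\<in>carrier (add_monoid L). Y \<otimes>\<^bsub>add_monoid L\<^esub> X = \<one>\<^bsub>add_monoid L\<^esub>"
    using xyz F_closed(3) by (intro bexI[of _ "cls (- x)"]) (simp_all add: add_L zero_L carrier_L)
qed (simp add: zero_L carrier_L F_closed)

lemma minus_L:
  assumes "x \<in> carrier F"
  shows "inv\<^bsub>add_monoid L\<^esub> (cls x) = cls (- x)"
  by (rule group.inv_equality[OF comm_group.axioms(2)[OF comm_group_L]])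
    (use assms in \<open>simp_all add: add_L zero_L carrier_L F_closed\<close>)

lemma tens_conv: "tens t m = cls (frag_of (t, m))"
  by (simp add: simple_tensor_def)

lemma tens_in_carrier: "\<lbrakk>t \<in> carrier T; m \<in> carrier M\<rbrakk> \<Longrightarrow> tens t m \<in> carrier L"
  by (simp add: tens_conv carrier_L F_closed)

lemma tens_add_right:
  assumes "t \<in> carrier T" "m \<in> carrier M" "n \<in> carrier M"
  shows "tens t (m \<oplus>\<^bsub>M\<^esub> n) = tens t m \<oplus>\<^bsub>L\<^esub> tens t n"
proof -
  have "frag_of (t, m \<oplus>\<^bsub>M\<^esub> n) - frag_of (t, m) - frag_of (t, n) \<in> K"
    by (rule relator_in_K) (use assms in \<open>auto simp: tensor_relators_def\<close>)
  then show ?thesis by (simp add: tens_conv add_L cls_eq_iff diff_diff_add)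
qed

lemma tens_balanced:
  assumes "t \<in> carrier T" "r \<in> carrier R" "m \<in> carrier M"
  shows "tens (t \<otimes>\<^bsub>T\<^esub> ore_emb R S r) m = tens t (r \<odot>\<^bsub>M\<^esub> m)"
proof -
  have "frag_of (t \<otimes>\<^bsub>T\<^esub> ore_emb R S r, m) - frag_of (t, r \<odot>\<^bsub>M\<^esub> m) \<in> K"
    by (rule relator_in_K) (use assms in \<open>auto simp: tensor_relators_def\<close>)
  then show ?thesis by (simp add: tens_conv cls_eq_iff)
qed

lemma smult_tens: "t \<in> carrier T \<Longrightarrow> t \<odot>\<^bsub>L\<^esub> tens u m = tens (t \<otimes>\<^bsub>T\<^esub> u) m"
  by (simp add: tens_conv smult_L)

lemma tens_zero_right:
  assumes "t \<in> carrier T"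
  shows "tens t \<zero>\<^bsub>M\<^esub> = \<zero>\<^bsub>L\<^esub>"
proof -
  have "tens t \<zero>\<^bsub>M\<^esub> = tens t \<zero>\<^bsub>M\<^esub> \<oplus>\<^bsub>L\<^esub> tens t \<zero>\<^bsub>M\<^esub>"
    using tens_add_right[of t "\<zero>\<^bsub>M\<^esub>" "\<zero>\<^bsub>M\<^esub>"] assms by simp
  then show ?thesis
    using K_closed(4) by (force simp: tens_conv zero_L add_L cls_eq_iff)
qed

lemma tens_minus_right:
  assumes "t \<in> carrier T" "m \<in> carrier M"
  shows "tens t (\<ominus>\<^bsub>M\<^esub> m) = inv\<^bsub>add_monoid L\<^esub> (tens t m)"
proof -
  have "tens t (\<ominus>\<^bsub>M\<^esub> m) \<oplus>\<^bsub>L\<^esub> tens t m = \<zero>\<^bsub>L\<^esub>"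
    using assms by (simp flip: tens_add_right add: M.l_neg tens_zero_right)
  then show ?thesis
    using group.inv_equality[OF comm_group.axioms(2)[OF comm_group_L], of "tens t (\<ominus>\<^bsub>M\<^esub> m)" "tens t m"]
      assms by (simp add: tens_in_carrier)
qed

section \<open>Fractions of module elements\<close>

lemma one_frac_closed: "s \<in> S \<Longrightarrow> frac s \<one> \<in> carrier T"
  by (simp add: frac_in_carrier)

lemma tens_frac:
  assumes "d \<in> S" "a \<in> carrier R" "m \<in> carrier M"
  shows "tens (frac d a) m = mod_frac R S M d (a \<odot>\<^bsub>M\<^esub> m)"
  using tens_balanced[OF one_frac_closed, of d a m] frac_mult_emb[of d \<one> a] assms
  by (simp add: mod_frac_def)

lemma add_mod_frac:
  assumes "d \<in> S" "m \<in> carrier M" "n \<in> carrier M"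
  shows "mod_frac R S M d m \<oplus>\<^bsub>L\<^esub> mod_frac R S M d n = mod_frac R S M d (m \<oplus>\<^bsub>M\<^esub> n)"
  using assms by (simp add: mod_frac_def tens_add_right one_frac_closed)

lemma mod_frac_common_denominator:
  assumes "s \<in> S" "s' \<in> S" "m \<in> carrier M" "m' \<in> carrier M"
  obtains d a a' where "d \<in> S" "a \<in> carrier R" "a' \<in> carrier R"
    "mod_frac R S M s m = mod_frac R S M d (a \<odot>\<^bsub>M\<^esub> m)"
    "mod_frac R S M s' m' = mod_frac R S M d (a' \<odot>\<^bsub>M\<^esub> m')"
proof -
  obtain d a a' where *: "d \<in> S" "a \<in> carrier R" "a' \<in> carrier R"
    "frac s \<one> = frac d a" "frac s' \<one> = frac d a'"
    using common_denominator[OF one_frac_closed[OF assms(1)] one_frac_closed[OF assms(2)]] .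
  show thesis
    by (rule that[OF *(1-3)]) (use * assms in \<open>simp_all flip: tens_frac, simp_all add: mod_frac_def\<close>)
qed

lemma smult_mod_frac:
  assumes "d \<in> S" "c \<in> carrier R" "s \<in> S" "m \<in> carrier M"
  shows "frac d (c \<otimes> s) \<odot>\<^bsub>L\<^esub> mod_frac R S M s m = mod_frac R S M d (c \<odot>\<^bsub>M\<^esub> m)"
proof -
  have "frac d (c \<otimes> s) \<odot>\<^bsub>L\<^esub> mod_frac R S M s m = tens (frac d c) m"
    using assms mult_frac[of d c s \<one>]
    by (simp add: mod_frac_def smult_tens frac_in_carrier S_closed)
  then show ?thesis using assms by (simp add: tens_frac)
qed

lemma mod_frac_in_loc_submodule: "\<lbrakk>s \<in> S; p \<in> P\<rbrakk> \<Longrightarrow> mod_frac R S M s p \<in> loc_submodule R S M P"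
  unfolding loc_submodule_def by blast

lemma submoduleD:
  assumes "submodule P R M"
  shows "P \<subseteq> carrier M" "\<zero>\<^bsub>M\<^esub> \<in> P" "\<lbrakk>p \<in> P; q \<in> P\<rbrakk> \<Longrightarrow> p \<oplus>\<^bsub>M\<^esub> q \<in> P"
    "p \<in> P \<Longrightarrow> \<ominus>\<^bsub>M\<^esub> p \<in> P" "\<lbrakk>a \<in> carrier R; p \<in> P\<rbrakk> \<Longrightarrow> a \<odot>\<^bsub>M\<^esub> p \<in> P"
proof -
  interpret submodule P R M by fact
  show "P \<subseteq> carrier M" "\<zero>\<^bsub>M\<^esub> \<in> P" "\<lbrakk>p \<in> P; q \<in> P\<rbrakk> \<Longrightarrow> p \<oplus>\<^bsub>M\<^esub> q \<in> P"
    "p \<in> P \<Longrightarrow> \<ominus>\<^bsub>M\<^esub> p \<in> P" "\<lbrakk>a \<in> carrier R; p \<in> P\<rbrakk> \<Longrightarrow> a \<odot>\<^bsub>M\<^esub> p \<in> P"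
    using subset m_closed one_closed m_inv_closed smult_closed by (auto simp: a_inv_def)
qed

lemma submoduleI:
  assumes "P \<subseteq> carrier M" "\<zero>\<^bsub>M\<^esub> \<in> P" "\<And>p q. \<lbrakk>p \<in> P; q \<in> P\<rbrakk> \<Longrightarrow> p \<oplus>\<^bsub>M\<^esub> q \<in> P"
    "\<And>p. p \<in> P \<Longrightarrow> \<ominus>\<^bsub>M\<^esub> p \<in> P" "\<And>a p. \<lbrakk>a \<in> carrier R; p \<in> P\<rbrakk> \<Longrightarrow> a \<odot>\<^bsub>M\<^esub> p \<in> P"
  shows "submodule P R M"
  by (intro submodule.intro subgroup.intro submodule_axioms.intro)
    (use assms in \<open>auto simp flip: a_inv_def\<close>)

lemma submodule_loc_submodule:
  assumes P: "submodule P R M"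
  shows "submodule (loc_submodule R S M P) T L"
proof (intro submodule.intro subgroup.intro submodule_axioms.intro)
  note P_in_M = subsetD[OF submoduleD(1)[OF P]]
  show "loc_submodule R S M P \<subseteq> carrier (add_monoid L)"
    by (auto simp: loc_submodule_def mod_frac_def P_in_M one_frac_closed intro!: tens_in_carrier)
  show "x \<otimes>\<^bsub>add_monoid L\<^esub> y \<in> loc_submodule R S M P"
    if xy: "x \<in> loc_submodule R S M P" "y \<in> loc_submodule R S M P" for x y
  proof -
    obtain s p s' p' where x: "s \<in> S" "p \<in> P" "x = mod_frac R S M s p"
      and y: "s' \<in> S" "p' \<in> P" "y = mod_frac R S M s' p'"
      using xy unfolding loc_submodule_def by blast
    obtain d a a' where da: "d \<in> S" "a \<in> carrier R" "a' \<in> carrier R"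
      and *: "x = mod_frac R S M d (a \<odot>\<^bsub>M\<^esub> p)" "y = mod_frac R S M d (a' \<odot>\<^bsub>M\<^esub> p')"
      using mod_frac_common_denominator[OF x(1) y(1) P_in_M[OF x(2)] P_in_M[OF y(2)]] x(3) y(3)
      by metis
    have "x \<oplus>\<^bsub>L\<^esub> y = mod_frac R S M d (a \<odot>\<^bsub>M\<^esub> p \<oplus>\<^bsub>M\<^esub> a' \<odot>\<^bsub>M\<^esub> p')"
      using x y da P_in_M unfolding * by (intro add_mod_frac smult_closed) auto
    moreover have "a \<odot>\<^bsub>M\<^esub> p \<oplus>\<^bsub>M\<^esub> a' \<odot>\<^bsub>M\<^esub> p' \<in> P"
      using x y da by (intro submoduleD(3,5)[OF P])
    ultimately show ?thesis
      using da by (simp add: mod_frac_in_loc_submodule)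
  qed
  show "\<one>\<^bsub>add_monoid L\<^esub> \<in> loc_submodule R S M P"
    using tens_zero_right[OF one_frac_closed[OF one_in_S]] one_in_S submoduleD(2)[OF P]
    by (force simp: loc_submodule_def mod_frac_def)
  show "inv\<^bsub>add_monoid L\<^esub> x \<in> loc_submodule R S M P" if "x \<in> loc_submodule R S M P" for x
  proof -
    obtain s p where x: "s \<in> S" "p \<in> P" "x = mod_frac R S M s p"
      using \<open>x \<in> _\<close> unfolding loc_submodule_def by blast
    have "inv\<^bsub>add_monoid L\<^esub> x = mod_frac R S M s (\<ominus>\<^bsub>M\<^esub> p)"
      using x P_in_M by (simp add: mod_frac_def tens_minus_right one_frac_closed)
    then show ?thesis
      using x submoduleD(4)[OF P] by (simp add: mod_frac_in_loc_submodule)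
  qed
  show "t \<odot>\<^bsub>L\<^esub> x \<in> loc_submodule R S M P" if t: "t \<in> carrier T" and "x \<in> loc_submodule R S M P" for t x
  proof -
    obtain s p where x: "s \<in> S" "p \<in> P" "x = mod_frac R S M s p"
      using \<open>x \<in> _\<close> unfolding loc_submodule_def by blast
    obtain d c where "d \<in> S" "c \<in> carrier R" "t = frac d (c \<otimes> s)"
      using compatible_denominator[OF t x(1)] .
    then show ?thesis
      using x P_in_M submoduleD(5)[OF P] by (auto simp: smult_mod_frac intro!: mod_frac_in_loc_submodule)
  qed
qed

lemma carrier_L_eq_fractions: "carrier L = loc_submodule R S M (carrier M)"
proof -
  have "submodule (carrier M) R M"
    by (rule submoduleI) (simp_all add: smult_closed)
  then interpret N: submodule "loc_submodule R S M (carrier M)" T L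
    by (rule submodule_loc_submodule)
  have "cls x \<in> loc_submodule R S M (carrier M)" if "x \<in> carrier F" for x
  proof -
    have x: "Poly_Mapping.keys x \<subseteq> carrier T \<times> carrier M"
      using that by (simp add: tensor_free_def)
    show ?thesis
    proof (rule free_Abelian_group_induct[OF x])
      show "cls 0 \<in> loc_submodule R S M (carrier M)"
        using N.one_closed by (simp add: zero_L)
      show "cls (x - y) \<in> loc_submodule R S M (carrier M)"
        if "Poly_Mapping.keys y \<subseteq> carrier T \<times> carrier M"
          "cls x \<in> loc_submodule R S M (carrier M)" "cls y \<in> loc_submodule R S M (carrier M)"
        for x y
      proof -
        have "y \<in> carrier F" using that(1) by (simp add: tensor_free_def)
        then show ?thesis
          using N.m_closed[OF that(2) N.m_inv_closed[OF that(3)]] by (simp add: minus_L add_L)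
      qed
      show "cls (frag_of z) \<in> loc_submodule R S M (carrier M)"
        if zc: "z \<in> carrier T \<times> carrier M" for z
      proof -
        obtain t m where z: "z = (t, m)" "t \<in> carrier T" "m \<in> carrier M" using zc by auto
        obtain d a where "d \<in> S" "a \<in> carrier R" "t = frac d a"
          using z(2) by (rule carrier_cases)
        then show ?thesis
          using z tens_frac[of d a m] by (simp add: tens_conv smult_closed mod_frac_in_loc_submodule)
      qed
    qed
  qed
  then show ?thesis using N.subset by (auto simp: carrier_L)
qed

section \<open>Equality of fractions\<close>

text \<open>The homomorphism \<open>(t, m) \<mapsto> (d t) m\<close> to \<open>M\<close>. It is defined for every \<open>d\<close>, but is meaningful
  only on those \<open>(t, m)\<close> where \<open>d\<close> is a denominator of \<open>t\<close>.\<close>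

lemma evaluation_hom:
  obtains h where "h \<in> hom F (add_monoid M)"
    "\<And>t m. \<lbrakk>t \<in> carrier T; m \<in> carrier M\<rbrakk> \<Longrightarrow> h (frag_of (t, m)) = numerator d t \<odot>\<^bsub>M\<^esub> m"
proof -
  obtain h where "h \<in> hom (free_Abelian_group (carrier T \<times> carrier M)) (add_monoid M)"
    "\<And>z. z \<in> carrier T \<times> carrier M \<Longrightarrow> h (frag_of z) = (case z of (t, m) \<Rightarrow> numerator d t \<odot>\<^bsub>M\<^esub> m)"
    by (rule comm_group.free_Abelian_group_universal[OF M.a_comm_group,
        of "\<lambda>(t, m). numerator d t \<odot>\<^bsub>M\<^esub> m" "carrier T \<times> carrier M"])
      (auto simp: smult_closed numerator_closed)
  then show thesis using that by (simp add: tensor_free_def)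
qed

text \<open>A single evaluation \<open>h d\<close> need not kill all of \<open>K\<close>, as \<open>d\<close> may fail to be a denominator
  for some of the scalars involved. The vanishing for all multiples of some \<open>d\<close> that lie in
  \<open>S\<close> is the form
  that is inherited by sums.\<close>

lemma kernel_vanishes:
  assumes h: "\<And>d. h d \<in> hom F (add_monoid M)"
    "\<And>d t m. \<lbrakk>t \<in> carrier T; m \<in> carrier M\<rbrakk> \<Longrightarrow> h d (frag_of (t, m)) = numerator d t \<odot>\<^bsub>M\<^esub> m"
    and x: "x \<in> K"
  shows "\<exists>d\<in>S. \<forall>r\<in>carrier R. r \<otimes> d \<in> S \<longrightarrow> h (r \<otimes> d) x = \<zero>\<^bsub>M\<^esub>"
proof -
  have hom: "group_hom F (add_monoid M) (h e)" for e
    using group_F M.a_group h(1) by (intro group_hom.intro group_hom_axioms.intro)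
  have h_closed: "h e y \<in> carrier M" if "y \<in> carrier F" for e y
    using group_hom.hom_closed[OF hom that] by simp
  have h_zero: "h e 0 = \<zero>\<^bsub>M\<^esub>" for e
    using group_hom.hom_one[OF hom] by simp
  have h_add: "h e (y + z) = h e y \<oplus>\<^bsub>M\<^esub> h e z" if "y \<in> carrier F" "z \<in> carrier F" for e y z
    using group_hom.hom_mult[OF hom that] by simp
  have h_minus: "h e (- y) = \<ominus>\<^bsub>M\<^esub> h e y" if "y \<in> carrier F" for e y
    using group_hom.hom_inv[OF hom that] F_inv[OF that] by (simp add: a_inv_def)
  have h_diff: "h e (y - z) = h e y \<ominus>\<^bsub>M\<^esub> h e z" if "y \<in> carrier F" "z \<in> carrier F" for e y z
    using h_add[of y "- z" e] that by (simp add: h_minus F_closed a_minus_def)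
  have cancel: "p \<oplus>\<^bsub>M\<^esub> q \<ominus>\<^bsub>M\<^esub> p \<ominus>\<^bsub>M\<^esub> q = \<zero>\<^bsub>M\<^esub>" if "p \<in> carrier M" "q \<in> carrier M" for p q
  proof -
    have "p \<oplus>\<^bsub>M\<^esub> q \<ominus>\<^bsub>M\<^esub> p = q"
      using that by (simp add: a_minus_def M.a_ac(2)[of p q] M.a_assoc M.r_neg)
    then show ?thesis using that by (simp add: a_minus_def M.r_neg)
  qed
  show ?thesis using x
  proof (induction rule: K_induct)
    case zero
    then show ?case using one_in_S by (auto simp: h_zero)
  next
    case (relator x)
    then consider t u m where "t \<in> carrier T" "u \<in> carrier T" "m \<in> carrier M"
        "x = frag_of (t \<oplus>\<^bsub>T\<^esub> u, m) - frag_of (t, m) - frag_of (u, m)"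
      | t m n where "t \<in> carrier T" "m \<in> carrier M" "n \<in> carrier M"
        "x = frag_of (t, m \<oplus>\<^bsub>M\<^esub> n) - frag_of (t, m) - frag_of (t, n)"
      | t r m where "t \<in> carrier T" "r \<in> carrier R" "m \<in> carrier M"
        "x = frag_of (t \<otimes>\<^bsub>T\<^esub> ore_emb R S r, m) - frag_of (t, r \<odot>\<^bsub>M\<^esub> m)"
      unfolding tensor_relators_def by blast
    then show ?case
    proof cases
      case 1
      obtain d a b where d: "d \<in> S" "a \<in> carrier R" "b \<in> carrier R" "t = frac d a" "u = frac d b"
        using common_denominator[OF 1(1,2)] .
      have "h (r \<otimes> d) x = \<zero>\<^bsub>M\<^esub>" if r: "r \<in> carrier R" "r \<otimes> d \<in> S" for r
        using 1 d r
        by (simp add: h_diff h(2) F_closed T_add_closed)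
          (simp add: add_frac numerator_frac_expand r_distr smult_l_distr smult_closed cancel)
      then show ?thesis using d(1) by blast
    next
      case 2
      have "h e x = \<zero>\<^bsub>M\<^esub>" for e
        using 2 by (simp add: h_diff h(2) F_closed smult_r_distr numerator_closed smult_closed cancel)
      then show ?thesis using one_in_S by blast
    next
      case 3
      obtain d a where d: "d \<in> S" "a \<in> carrier R" "t = frac d a"
        using 3(1) by (rule carrier_cases)
      have "h (q \<otimes> d) x = \<zero>\<^bsub>M\<^esub>" if q: "q \<in> carrier R" "q \<otimes> d \<in> S" for q
        using 3 d q
        by (simp add: h_diff h(2) F_closed T_mult_closed emb_in_carrier smult_closed)
          (simp add: frac_mult_emb numerator_frac_expand smult_assoc smult_closed a_minus_def M.r_neg)
      then show ?thesis using d(1) by blast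
    qed
  next
    case (minus x)
    have zero: "\<ominus>\<^bsub>M\<^esub> \<zero>\<^bsub>M\<^esub> = \<zero>\<^bsub>M\<^esub>" by (rule M.minus_equality) simp_all
    obtain d where d: "d \<in> S" "\<And>r. \<lbrakk>r \<in> carrier R; r \<otimes> d \<in> S\<rbrakk> \<Longrightarrow> h (r \<otimes> d) x = \<zero>\<^bsub>M\<^esub>"
      using minus.IH by blast
    show ?case
      by (intro bexI[OF _ d(1)] ballI impI)
        (simp only: h_minus[OF K_closed(1)[OF minus.hyps]] d(2) zero)
  next
    case (add x y)
    obtain d where d: "d \<in> S" "\<And>r. \<lbrakk>r \<in> carrier R; r \<otimes> d \<in> S\<rbrakk> \<Longrightarrow> h (r \<otimes> d) x = \<zero>\<^bsub>M\<^esub>"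
      using add.IH(1) by blast
    obtain e where e: "e \<in> S" "\<And>r. \<lbrakk>r \<in> carrier R; r \<otimes> e \<in> S\<rbrakk> \<Longrightarrow> h (r \<otimes> e) y = \<zero>\<^bsub>M\<^esub>"
      using add.IH(2) by blast
    obtain u v where uv: "u \<in> S" "v \<in> carrier R" "u \<otimes> d = v \<otimes> e" "u \<otimes> d \<in> S"
      using common_multiple[OF d(1) e(1)] .
    have "h (r \<otimes> (u \<otimes> d)) (x + y) = \<zero>\<^bsub>M\<^esub>" if r: "r \<in> carrier R" "r \<otimes> (u \<otimes> d) \<in> S" for r
    proof -
      have "r \<otimes> (u \<otimes> d) = (r \<otimes> u) \<otimes> d" "r \<otimes> (u \<otimes> d) = (r \<otimes> v) \<otimes> e"
        using r uv d(1) e(1) by (simp_all add: S_closed m_assoc)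
      then have "h (r \<otimes> (u \<otimes> d)) x = \<zero>\<^bsub>M\<^esub>" "h (r \<otimes> (u \<otimes> d)) y = \<zero>\<^bsub>M\<^esub>"
        using d(2)[of "r \<otimes> u"] e(2)[of "r \<otimes> v"] r uv by (simp_all add: S_closed)
      then show ?thesis using add by (simp add: h_add K_closed)
    qed
    then show ?case using uv(4) by blast
  qed
qed

text \<open>Equal fractions become equal in \<open>M\<close> after multiplication by a common left multiple of their
  denominators. In particular, \<open>\<epsilon>(m) = \<epsilon>(m')\<close> only if \<open>s m = s m'\<close> for some \<open>s \<in> S\<close>.\<close>

lemma mod_frac_eqD:
  assumes eq: "mod_frac R S M s m = mod_frac R S M s' m'"
    and s: "s \<in> S" "s' \<in> S" and m: "m \<in> carrier M" "m' \<in> carrier M"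
  obtains a a' where "a \<in> carrier R" "a' \<in> carrier R" "a \<otimes> s \<in> S" "a \<otimes> s = a' \<otimes> s'"
    "a \<odot>\<^bsub>M\<^esub> m = a' \<odot>\<^bsub>M\<^esub> m'"
proof -
  have "\<forall>d. \<exists>h. h \<in> hom F (add_monoid M) \<and>
      (\<forall>t\<in>carrier T. \<forall>m\<in>carrier M. h (frag_of (t, m)) = numerator d t \<odot>\<^bsub>M\<^esub> m)"
    using evaluation_hom by metis
  then obtain h where h: "\<And>d. h d \<in> hom F (add_monoid M)"
    "\<And>d t m. \<lbrakk>t \<in> carrier T; m \<in> carrier M\<rbrakk> \<Longrightarrow> h d (frag_of (t, m)) = numerator d t \<odot>\<^bsub>M\<^esub> m"
    by metis
  let ?x = "frag_of (frac s \<one>, m)" and ?x' = "frag_of (frac s' \<one>, m')"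
  have xF: "?x \<in> carrier F" "?x' \<in> carrier F"
    using s m by (simp_all add: F_closed one_frac_closed)
  have "?x - ?x' \<in> K"
    using eq by (simp add: mod_frac_def tens_conv cls_eq_iff)
  then obtain d where d: "d \<in> S" "\<And>r. \<lbrakk>r \<in> carrier R; r \<otimes> d \<in> S\<rbrakk> \<Longrightarrow> h (r \<otimes> d) (?x - ?x') = \<zero>\<^bsub>M\<^esub>"
    using kernel_vanishes[OF h] by blast
  obtain u v where uv: "u \<in> S" "v \<in> carrier R" "u \<otimes> s = v \<otimes> s'" "u \<otimes> s \<in> S"
    using common_multiple[OF s] .
  \<comment> \<open>a common left multiple \<open>?e\<close> of \<open>s\<close>, \<open>s'\<close> and \<open>d\<close>\<close>
  obtain p q where pq: "p \<in> S" "q \<in> carrier R" "p \<otimes> (u \<otimes> s) = q \<otimes> d" "p \<otimes> (u \<otimes> s) \<in> S"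
    using common_multiple[OF uv(4) d(1)] .
  let ?e = "p \<otimes> (u \<otimes> s)"
  interpret h: group_hom F "add_monoid M" "h ?e"
    using group_F M.a_group h(1) by (intro group_hom.intro group_hom_axioms.intro)
  have eqs: "?e = (p \<otimes> u) \<otimes> s" "?e = (p \<otimes> v) \<otimes> s'"
    using uv pq s by (simp_all add: S_closed m_assoc)
  have "numerator ?e (frac s \<one>) = p \<otimes> u" "numerator ?e (frac s' \<one>) = p \<otimes> v"
    using numerator_frac_expand[of s \<one> "p \<otimes> u"] numerator_frac_expand[of s' \<one> "p \<otimes> v"] uv pq s
    by (simp_all add: S_closed eqs[symmetric])
  then have hx: "h ?e ?x = (p \<otimes> u) \<odot>\<^bsub>M\<^esub> m" "h ?e ?x' = (p \<otimes> v) \<odot>\<^bsub>M\<^esub> m'"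
    using s m by (simp_all add: h(2) one_frac_closed)
  have "h ?e (?x - ?x') = \<zero>\<^bsub>M\<^esub>"
    using d(2)[of q] pq by simp
  then have "h ?e ?x = h ?e ?x'"
    using h.hom_mult[of "?x - ?x'" ?x'] h.hom_closed[OF xF(2)] F_closed(4)[OF xF] xF by simp
  then show thesis
    using hx uv pq eqs s by (intro that[of "p \<otimes> u" "p \<otimes> v"]) (simp_all add: S_closed)
qed

section \<open>Extension, contraction and local closure\<close>

lemma extension_eq_loc_submodule:
  assumes P: "submodule P R M"
  shows "extension R S M P = loc_submodule R S M P"
proof
  have "loc_map R S M ` P \<subseteq> loc_submodule R S M P"
    by (auto simp: loc_map_def one_in_S mod_frac_in_loc_submodule)
  then show "extension R S M P \<subseteq> loc_submodule R S M P"
    unfolding extension_def submodule_generated_def using submodule_loc_submodule[OF P] by blast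
  have "mod_frac R S M s p \<in> N"
    if "submodule N T L" "loc_map R S M ` P \<subseteq> N" "s \<in> S" "p \<in> P" for N s p
  proof -
    have "frac s \<one> \<odot>\<^bsub>L\<^esub> loc_map R S M p = mod_frac R S M s p"
      using smult_mod_frac[of s \<one> \<one> p] that(3,4) submoduleD(1)[OF P]
      by (auto simp: loc_map_def one_in_S smult_one)
    moreover have "frac s \<one> \<odot>\<^bsub>L\<^esub> loc_map R S M p \<in> N"
      using submodule.smult_closed[OF that(1) one_frac_closed] that by blast
    ultimately show ?thesis by simp
  qed
  then show "loc_submodule R S M P \<subseteq> extension R S M P"
    unfolding extension_def submodule_generated_def loc_submodule_def by blast
qed

lemma submodule_contraction:
  assumes Q: "submodule Q T L"
  shows "submodule (contraction R S M Q) R M"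
proof -
  interpret Q: submodule Q T L by fact
  show ?thesis
  proof (rule submoduleI)
    show "\<zero>\<^bsub>M\<^esub> \<in> contraction R S M Q"
      using Q.one_closed
      by (simp add: contraction_def loc_map_def mod_frac_def tens_zero_right one_frac_closed one_in_S)
    show "p \<oplus>\<^bsub>M\<^esub> q \<in> contraction R S M Q"
      if "p \<in> contraction R S M Q" "q \<in> contraction R S M Q" for p q
      using that Q.m_closed[of "loc_map R S M p" "loc_map R S M q"]
      by (simp add: contraction_def loc_map_def add_mod_frac one_in_S)
    show "\<ominus>\<^bsub>M\<^esub> p \<in> contraction R S M Q" if "p \<in> contraction R S M Q" for p
      using that Q.m_inv_closed[of "loc_map R S M p"]
      by (simp add: contraction_def loc_map_def mod_frac_def tens_minus_right one_frac_closed one_in_S)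
    show "a \<odot>\<^bsub>M\<^esub> p \<in> contraction R S M Q" if "a \<in> carrier R" "p \<in> contraction R S M Q" for a p
    proof -
      have p: "p \<in> carrier M" "loc_map R S M p \<in> Q"
        using that(2) by (simp_all add: contraction_def)
      have "frac \<one> a \<odot>\<^bsub>L\<^esub> loc_map R S M p = loc_map R S M (a \<odot>\<^bsub>M\<^esub> p)"
        using smult_mod_frac[of \<one> a \<one> p] that(1) p(1) by (simp add: loc_map_def one_in_S)
      moreover have "frac \<one> a \<odot>\<^bsub>L\<^esub> loc_map R S M p \<in> Q"
        by (rule Q.smult_closed) (use that(1) p in \<open>simp_all add: frac_in_carrier one_in_S\<close>)
      moreover have "a \<odot>\<^bsub>M\<^esub> p \<in> carrier M"
        using that(1) p(1) by (rule left_module.smult_closed[OF left_module_axioms])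
      ultimately show ?thesis
        by (simp add: contraction_def)
    qed
  qed (auto simp: contraction_def)
qed

lemma loc_submodule_contraction:
  assumes Q: "submodule Q T L"
  shows "loc_submodule R S M (contraction R S M Q) = Q"
proof
  interpret Q: submodule Q T L by fact
  show "loc_submodule R S M (contraction R S M Q) \<subseteq> Q"
  proof
    fix x assume "x \<in> loc_submodule R S M (contraction R S M Q)"
    then obtain s m where x: "s \<in> S" "m \<in> carrier M" "loc_map R S M m \<in> Q" "x = mod_frac R S M s m"
      by (auto simp: loc_submodule_def contraction_def)
    have "frac s \<one> \<odot>\<^bsub>L\<^esub> loc_map R S M m = x"
      using smult_mod_frac[of s \<one> \<one> m] x by (simp add: loc_map_def one_in_S smult_one)
    then show "x \<in> Q" using Q.smult_closed[OF one_frac_closed[OF x(1)] x(3)] by simp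
  qed
  show "Q \<subseteq> loc_submodule R S M (contraction R S M Q)"
  proof
    fix x assume "x \<in> Q"
    then have "x \<in> loc_submodule R S M (carrier M)"
      using Q.subset carrier_L_eq_fractions by auto
    then obtain s m where x: "s \<in> S" "m \<in> carrier M" "x = mod_frac R S M s m"
      unfolding loc_submodule_def by blast
    have "frac \<one> s \<odot>\<^bsub>L\<^esub> x = loc_map R S M m"
      using smult_mod_frac[of \<one> \<one> s m] x by (simp add: loc_map_def one_in_S S_closed smult_one)
    then have "loc_map R S M m \<in> Q"
      using Q.smult_closed[of "frac \<one> s" x] \<open>x \<in> Q\<close> x(1)
      by (simp add: frac_in_carrier one_in_S S_closed)
    then show "x \<in> loc_submodule R S M (contraction R S M Q)"
      using x by (simp add: contraction_def mod_frac_in_loc_submodule)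
  qed
qed

lemma contraction_loc_submodule:
  assumes P: "submodule P R M"
  shows "contraction R S M (loc_submodule R S M P) = local_closure S M P"
proof
  show "contraction R S M (loc_submodule R S M P) \<subseteq> local_closure S M P"
  proof
    fix m assume "m \<in> contraction R S M (loc_submodule R S M P)"
    then obtain s p where m: "m \<in> carrier M" and sp: "s \<in> S" "p \<in> P"
      and eq: "mod_frac R S M \<one> m = mod_frac R S M s p"
      by (auto simp: contraction_def loc_map_def loc_submodule_def)
    have p: "p \<in> carrier M" using sp(2) submoduleD(1)[OF P] by blast
    obtain a a' where a: "a \<in> carrier R" "a' \<in> carrier R" "a \<otimes> \<one> \<in> S"
        "a \<odot>\<^bsub>M\<^esub> m = a' \<odot>\<^bsub>M\<^esub> p"
      using mod_frac_eqD[OF eq one_in_S sp(1) m p] .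
    then show "m \<in> local_closure S M P"
      using m submoduleD(5)[OF P a(2) sp(2)] by (auto simp: local_closure_def intro!: bexI[of _ a])
  qed
  show "local_closure S M P \<subseteq> contraction R S M (loc_submodule R S M P)"
  proof
    fix m assume "m \<in> local_closure S M P"
    then obtain s where m: "m \<in> carrier M" and s: "s \<in> S" "s \<odot>\<^bsub>M\<^esub> m \<in> P"
      by (auto simp: local_closure_def)
    have "loc_map R S M m = tens (frac s s) m"
      using frac_expand[of \<one> \<one> s] s(1) by (simp add: loc_map_def mod_frac_def one_in_S S_closed)
    also have "\<dots> = mod_frac R S M s (s \<odot>\<^bsub>M\<^esub> m)"
      using s(1) m by (simp add: tens_frac S_closed)
    finally show "m \<in> contraction R S M (loc_submodule R S M P)"
      using s m by (simp add: contraction_def mod_frac_in_loc_submodule)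
  qed
qed

end

theorem lemma10p8:
  fixes R :: "('a, 'r) ring_scheme"
    and S :: "'a set"
    and M :: "('a, 'b, 'm) module_scheme"
  assumes "nc_domain R"
    and "left_ore_set R S"
    and "left_module R M"
  shows
    "(\<forall>Q. submodule Q (ore_loc R S) (ore_mod R S M) \<longrightarrow>
        Q = extension R S M (contraction R S M Q) \<and>
        (\<exists>P. submodule P R M \<and> Q = extension R S M P)) \<and>
     (\<forall>P. submodule P R M \<longrightarrow>
        extension R S M P = loc_submodule R S M P \<and>
        contraction R S M (extension R S M P) = local_closure S M P \<and>
        submodule (local_closure S M P) R M)"
proof (intro conjI allI impI)
  interpret ore_module R S M
    using assms by (simp add: ore_module_def ore_domain_def ore_domain_axioms_def)
  fix Q assume Q: "submodule Q (ore_loc R S) (ore_mod R S M)"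
  show eq: "Q = extension R S M (contraction R S M Q)"
    using extension_eq_loc_submodule[OF submodule_contraction[OF Q]] loc_submodule_contraction[OF Q]
    by simp
  show "\<exists>P. submodule P R M \<and> Q = extension R S M P"
    using submodule_contraction[OF Q] eq by blast
next
  interpret ore_module R S M
    using assms by (simp add: ore_module_def ore_domain_def ore_domain_axioms_def)
  fix P assume P: "submodule P R M"
  show ext: "extension R S M P = loc_submodule R S M P"
    by (rule extension_eq_loc_submodule[OF P])
  show "contraction R S M (extension R S M P) = local_closure S M P"
    unfolding ext by (rule contraction_loc_submodule[OF P])
  show "submodule (local_closure S M P) R M"
    using submodule_contraction[OF submodule_loc_submodule[OF P]]
    by (simp add: contraction_loc_submodule[OF P])
qed

end
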